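(* Let $D_1,\dots,D_m$ be nonempty closed subsets of $\mathbb{R}^n$. Let $\{\varphi_{\epsilon_k}\}$ be a sequence of continuous functions on $\mathbb{R}$ that is both epi-convergent and pointwise convergent to $|\cdot|_0$ on $\mathbb{R}$. Define $\Phi_{\epsilon_k}(x) := \sum_{i=1}^m \varphi_{\epsilon_k}(d_{D_i}^2(x))$ for $x\in\mathbb{R}^n$. Then $\{\Phi_{\epsilon_k}\}$ is both epi-convergent and pointwise convergent to $\Phi_0$, where $\Phi_0(x) := \sum_{i=1}^{m}|d_{D_i}^2(x)|_0$.
   Context: For $s\in\mathbb{R}$, $|s|_0$ is the $\ell_0$ norm of $s$: $|s|_0 = 0$ if $s=0$ and $|s|_0=1$ otherwise. For a nonempty closed set $D\subseteq\mathbb{R}^n$, $d_D(x)=\inf_{y\in D}\|x-y\|$ is the Euclidean distance from $x$ to $D$. A sequence of functions $f_k$ on $\mathbb{R}^p$ epi-converges to $f$ if for every $x$: $\liminf_{k\to\infty} f_k(x^k)\ge f(x)$ for every sequence $x^k\to x$, and $\limsup_{k\to\infty} f_k(x^k)\le f(x)$ for some sequence $x^k\to x$. *)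

theory Defs
  imports "HOL-Analysis.Analysis"
begin

definition l0 :: "real \<Rightarrow> real" where
  "l0 s = (if s = 0 then 0 else 1)"

text \<open>Lower and upper limits are taken in the extended reals, since they may be infinite even
  for real-valued functions.\<close>

definition epi_converges :: "(nat \<Rightarrow> 'a::topological_space \<Rightarrow> real) \<Rightarrow> ('a \<Rightarrow> real) \<Rightarrow> bool" where
  "epi_converges f g \<longleftrightarrow>
     (\<forall>x. (\<forall>X. X \<longlonglongrightarrow> x \<longrightarrow> ereal (g x) \<le> liminf (\<lambda>k. ereal (f k (X k)))) \<and>
          (\<exists>X. X \<longlonglongrightarrow> x \<and> limsup (\<lambda>k. ereal (f k (X k))) \<le> ereal (g x)))"

definition pointwise_converges :: "(nat \<Rightarrow> 'a \<Rightarrow> real) \<Rightarrow> ('a \<Rightarrow> real) \<Rightarrow> bool" where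
  "pointwise_converges f g \<longleftrightarrow> (\<forall>x. (\<lambda>k. f k x) \<longlonglongrightarrow> g x)"

text \<open>With \<open>h = \<phi>\<^sub>k\<close> this is the approximation \<open>\<Phi>\<^sub>k\<close>, and with
  \<open>h = l0\<close> it is \<open>\<Phi>\<^sub>0\<close>. For a nonempty set, \<^const>\<open>infdist\<close> is
  the infimum of the distances to its points.\<close>

definition sum_sq_dist ::
  "nat \<Rightarrow> (nat \<Rightarrow> 'a::metric_space set) \<Rightarrow> (real \<Rightarrow> real) \<Rightarrow> 'a \<Rightarrow> real" where
  "sum_sq_dist m D h x = (\<Sum>i = 1..m. h ((infdist x (D i))\<^sup>2))"

end

theory Submission
  imports Defs
begin

text \<open>Squared distance functions are continuous, so a sequence converging to \<open>x\<close> is mapped by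
  \<open>d\<^sup>2\<close> of each set to a sequence of reals converging to the value at \<open>x\<close>; the lower bounds
  for \<open>\<phi>\<close> along these sequences then add up, as they are finite. For the
  upper bound, pointwise convergence makes the constant sequence a recovery sequence.\<close>

text \<open>Trades a lower limit in the extended reals for an epsilon condition on reals, so that
  bounds can be added by real arithmetic.\<close>

lemma ereal_le_liminf_iff:
  fixes f :: "nat \<Rightarrow> real"
  shows "ereal a \<le> liminf (\<lambda>k. ereal (f k)) \<longleftrightarrow> (\<forall>e>0. \<forall>\<^sub>F k in sequentially. a - e < f k)"
proof
  assume "ereal a \<le> liminf (\<lambda>k. ereal (f k))"
  then have *: "\<forall>\<^sub>F k in sequentially. y < ereal (f k)" if "y < ereal a" for y
    using that unfolding le_Liminf_iff by blast
  show "\<forall>e>0. \<forall>\<^sub>F k in sequentially. a - e < f k"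
    using *[of "ereal (a - e)" for e] by simp
next
  assume *: "\<forall>e>0. \<forall>\<^sub>F k in sequentially. a - e < f k"
  show "ereal a \<le> liminf (\<lambda>k. ereal (f k))"
    unfolding le_Liminf_iff
  proof (intro allI impI)
    fix y assume y: "y < ereal a"
    show "\<forall>\<^sub>F k in sequentially. y < ereal (f k)"
    proof (cases y)
      case (real r)
      \<comment> \<open>The choice \<open>e = a - r\<close> is positive since
        \<open>y < ereal a\<close>, and it makes \<open>a - e\<close> equal to
        \<open>r\<close>.\<close>
      then show ?thesis using *[rule_format, of "a - r"] y by simp
    \<comment> \<open>Minus infinity lies below every real value, and plus infinity contradicts
      \<open>y < ereal a\<close>.\<close>
    qed (use y in auto)
  qed
qed

text \<open>By induction on \<open>I\<close>: a margin \<open>e\<close> for the enlarged sum is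
  split evenly between the new term and the old sum, both of whose bounds hold eventually.\<close>

lemma ereal_sum_le_liminf_sum:
  fixes f :: "'i \<Rightarrow> nat \<Rightarrow> real"
  assumes "finite I" and "\<And>i. i \<in> I \<Longrightarrow> ereal (a i) \<le> liminf (\<lambda>k. ereal (f i k))"
  shows "ereal (\<Sum>i\<in>I. a i) \<le> liminf (\<lambda>k. ereal (\<Sum>i\<in>I. f i k))"
  using assms
proof (induction I rule: finite_induct)
  case (insert j I)
  have "\<forall>\<^sub>F k in sequentially. a j + sum a I - e < f j k + (\<Sum>i\<in>I. f i k)" if "e > 0" for e
  proof -
    have "\<forall>\<^sub>F k in sequentially. a j - e / 2 < f j k"
      "\<forall>\<^sub>F k in sequentially. sum a I - e / 2 < (\<Sum>i\<in>I. f i k)"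
      using insert that by (simp_all add: ereal_le_liminf_iff)
    then show ?thesis by eventually_elim linarith
  qed
  then show ?case using insert.hyps by (simp add: ereal_le_liminf_iff)
qed (simp add: ereal_le_liminf_iff)

lemma epi_converges_if_liminf_and_pointwise:
  assumes "\<And>x X. X \<longlonglongrightarrow> x \<Longrightarrow> ereal (g x) \<le> liminf (\<lambda>k. ereal (f k (X k)))"
    and "pointwise_converges f g"
  shows "epi_converges f g"
proof -
  have "\<exists>X. X \<longlonglongrightarrow> x \<and> limsup (\<lambda>k. ereal (f k (X k))) \<le> ereal (g x)" for x
  proof (intro exI[of _ "\<lambda>_. x"] conjI)
    \<comment> \<open>Along the constant sequence the limit exists, so the upper limit equals
      it.\<close>
    have "(\<lambda>k. ereal (f k x)) \<longlonglongrightarrow> ereal (g x)"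
      using assms(2) by (simp add: pointwise_converges_def)
    then show "limsup (\<lambda>k. ereal (f k x)) \<le> ereal (g x)"
      using lim_imp_Limsup[OF sequentially_bot] by (metis order_refl)
  qed simp
  then show ?thesis using assms(1) unfolding epi_converges_def by blast
qed

theorem theorem3p1:
  fixes m :: nat
    and D :: "nat \<Rightarrow> (real ^ 'n) set"
    and \<phi> :: "nat \<Rightarrow> real \<Rightarrow> real"
  assumes "\<And>i. i \<in> {1..m} \<Longrightarrow> closed (D i)"
    and "\<And>i. i \<in> {1..m} \<Longrightarrow> D i \<noteq> {}"
    and "\<And>k. continuous_on UNIV (\<phi> k)"
    and "epi_converges \<phi> l0"
    and "pointwise_converges \<phi> l0"
  shows "epi_converges (\<lambda>k. sum_sq_dist m D (\<phi> k)) (sum_sq_dist m D l0) \<and>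
         pointwise_converges (\<lambda>k. sum_sq_dist m D (\<phi> k)) (sum_sq_dist m D l0)"
proof
  show pw: "pointwise_converges (\<lambda>k. sum_sq_dist m D (\<phi> k)) (sum_sq_dist m D l0)"
    using assms(5) unfolding pointwise_converges_def sum_sq_dist_def
    \<comment> \<open>For fixed \<open>x\<close> each squared distance is a fixed real, so this is a
      finite sum of pointwise limits.\<close>
    by (auto intro!: tendsto_sum)
  show "epi_converges (\<lambda>k. sum_sq_dist m D (\<phi> k)) (sum_sq_dist m D l0)"
  proof (rule epi_converges_if_liminf_and_pointwise[OF _ pw])
    fix x :: "real ^ 'n" and X
    assume "X \<longlonglongrightarrow> x"
    then have "(\<lambda>k. (infdist (X k) (D i))\<^sup>2) \<longlonglongrightarrow> (infdist x (D i))\<^sup>2" for i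
      by (intro tendsto_intros)
    then have "ereal (l0 ((infdist x (D i))\<^sup>2)) \<le> liminf (\<lambda>k. ereal (\<phi> k ((infdist (X k) (D i))\<^sup>2)))"
      for i
      \<comment> \<open>The liminf half of epi-convergence covers every convergent real sequence, in
        particular the squared distances along \<open>X\<close>.\<close>
      using assms(4) unfolding epi_converges_def by blast
    then show "ereal (sum_sq_dist m D l0 x) \<le> liminf (\<lambda>k. ereal (sum_sq_dist m D (\<phi> k) (X k)))"
      unfolding sum_sq_dist_def by (intro ereal_sum_le_liminf_sum) auto
  qed
qed

end
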